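(* Let $d\ge1$. For any fixed $\mu,\nu\in\mathcal{P}_1(\mathbb{R}^d)$: (i) the function $\sigma\mapsto\mathsf{W}_1^{(\sigma)}(\mu,\nu)$ is continuous and monotonically non-increasing on $[0,+\infty)$; (ii) $\lim_{\sigma\to0}\mathsf{W}_1^{(\sigma)}(\mu,\nu)=\mathsf{W}_1(\mu,\nu)$. Moreover, (iii) there exist $\mu,\nu\in\mathcal{P}_1(\mathbb{R}^d)$ such that $\lim_{\sigma\to\infty}\mathsf{W}_1^{(\sigma)}(\mu,\nu)\neq0$.
   Context: $\mathcal{P}_1(\mathbb{R}^d)$ is the set of Borel probability measures on $\mathbb{R}^d$ with finite first moment, $\int\|x\|\,d\mu(x)<\infty$, where $\|\cdot\|$ is the Euclidean norm. $\Pi(\mu,\nu)$ is the set of couplings of $\mu$ and $\nu$ (probability measures on $\mathbb{R}^d\times\mathbb{R}^d$ with marginals $\mu$ and $\nu$), and $\mathsf{W}_1(\mu,\nu)=\inf_{\pi\in\Pi(\mu,\nu)}\int\|x-y\|\,d\pi(x,y)$. For $\sigma\ge0$, $\mathcal{N}_\sigma=\mathcal{N}(0,\sigma^2 \mathrm{I}_d)$ is the isotropic Gaussian measure on $\mathbb{R}^d$ (with $\mathcal{N}_0=\delta_0$), $\ast$ is convolution of measures, and $\mathsf{W}_1^{(\sigma)}(\mu,\nu)=\mathsf{W}_1(\mu\ast\mathcal{N}_\sigma,\nu\ast\mathcal{N}_\sigma)$. *)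

theory Defs
  imports "HOL-Analysis.Analysis" "HOL-Probability.Probability"
begin

definition P1 :: "'a::euclidean_space measure set" where
  "P1 = {\<mu>. prob_space \<mu> \<and> sets \<mu> = sets borel \<and> integrable \<mu> norm}"

definition couplings :: "'a::euclidean_space measure \<Rightarrow> 'a measure \<Rightarrow> ('a \<times> 'a) measure set" where
  "couplings \<mu> \<nu> = {\<pi>. prob_space \<pi> \<and> sets \<pi> = sets borel \<and>
                        distr \<pi> borel fst = \<mu> \<and> distr \<pi> borel snd = \<nu>}"

(* Real-valued: for arguments in P1 the cost is integrable under every coupling
   (integrable_cost below), the set of couplings is nonempty (couplings_nonempty), and the
   values are bounded below by 0, so neither the integral nor the infimum takes a default value. *)
definition W1 :: "'a::euclidean_space measure \<Rightarrow> 'a measure \<Rightarrow> real" where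
  "W1 \<mu> \<nu> = (INF \<pi>\<in>couplings \<mu> \<nu>. \<integral>(x, y). norm (x - y) \<partial>\<pi>)"

definition isotropic_gaussian :: "real \<Rightarrow> 'a::euclidean_space measure" where
  "isotropic_gaussian \<sigma> =
     (if \<sigma> = 0 then return borel 0
      else density lborel
        (\<lambda>x. ennreal (exp (- (norm x)\<^sup>2 / (2 * \<sigma>\<^sup>2)) / sqrt (2 * pi * \<sigma>\<^sup>2) ^ DIM('a))))"

definition smooth_W1 :: "real \<Rightarrow> 'a::ordered_euclidean_space measure \<Rightarrow> 'a measure \<Rightarrow> real" where
  "smooth_W1 \<sigma> \<mu> \<nu> = W1 (\<mu> \<star> isotropic_gaussian \<sigma>) (\<nu> \<star> isotropic_gaussian \<sigma>)"

lemma integrable_cost: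
  assumes "\<mu> \<in> P1" "\<nu> \<in> P1" "\<pi> \<in> couplings \<mu> \<nu>"
  shows "integrable \<pi> (\<lambda>(x, y). norm (x - y))"
proof -
  have [measurable_cong]: "sets \<pi> = sets (borel \<Otimes>\<^sub>M borel)"
    using assms(3) unfolding borel_prod by (simp add: couplings_def)
  have "integrable (distr \<pi> borel fst) norm" "integrable (distr \<pi> borel snd) norm"
    using assms by (auto simp: P1_def couplings_def)
  then have "integrable \<pi> (\<lambda>p. norm (fst p))" "integrable \<pi> (\<lambda>p. norm (snd p))"
    by (simp_all add: integrable_distr_eq)
  then have "integrable \<pi> (\<lambda>p. norm (fst p) + norm (snd p))"
    by (rule Bochner_Integration.integrable_add)
  then show ?thesis
    by (rule Bochner_Integration.integrable_bound) (auto simp: norm_triangle_ineq4 split_beta)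
qed

lemma couplings_nonempty:
  assumes "\<mu> \<in> P1" "\<nu> \<in> P1"
  shows "\<mu> \<Otimes>\<^sub>M \<nu> \<in> couplings \<mu> \<nu>"
proof -
  have s [measurable_cong]: "sets \<mu> = sets borel" "sets \<nu> = sets borel"
    using assms by (auto simp: P1_def)
  interpret M: prob_space \<mu> using assms by (simp add: P1_def)
  interpret N: prob_space \<nu> using assms by (simp add: P1_def)
  interpret pair_prob_space \<mu> \<nu> ..
  have sp: "space \<mu> = UNIV" "space \<nu> = UNIV"
    using sets_eq_imp_space_eq[OF s(1)] sets_eq_imp_space_eq[OF s(2)] by auto
  have 1: "distr (\<mu> \<Otimes>\<^sub>M \<nu>) borel fst = \<mu>"
  proof (rule measure_eqI)
    fix A assume "A \<in> sets (distr (\<mu> \<Otimes>\<^sub>M \<nu>) borel fst)"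
    then have A: "A \<in> sets \<mu>" by (simp add: s)
    then have "emeasure (distr (\<mu> \<Otimes>\<^sub>M \<nu>) borel fst) A = emeasure (\<mu> \<Otimes>\<^sub>M \<nu>) (A \<times> space \<nu>)"
      by (subst emeasure_distr)
        (auto simp: s sp space_pair_measure intro!: arg_cong2[where f=emeasure])
    also have "\<dots> = emeasure \<mu> A"
      using A by (simp add: N.emeasure_pair_measure_Times N.emeasure_space_1)
    finally show "emeasure (distr (\<mu> \<Otimes>\<^sub>M \<nu>) borel fst) A = emeasure \<mu> A" .
  qed (simp add: s)
  have 2: "distr (\<mu> \<Otimes>\<^sub>M \<nu>) borel snd = \<nu>"
  proof (rule measure_eqI)
    fix A assume "A \<in> sets (distr (\<mu> \<Otimes>\<^sub>M \<nu>) borel snd)"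
    then have A: "A \<in> sets \<nu>" by (simp add: s)
    then have "emeasure (distr (\<mu> \<Otimes>\<^sub>M \<nu>) borel snd) A = emeasure (\<mu> \<Otimes>\<^sub>M \<nu>) (space \<mu> \<times> A)"
      by (subst emeasure_distr)
        (auto simp: s sp space_pair_measure intro!: arg_cong2[where f=emeasure])
    also have "\<dots> = emeasure \<nu> A"
      using A by (simp add: N.emeasure_pair_measure_Times M.emeasure_space_1)
    finally show "emeasure (distr (\<mu> \<Otimes>\<^sub>M \<nu>) borel snd) A = emeasure \<nu> A" .
  qed (simp add: s)
  have "sets (\<mu> \<Otimes>\<^sub>M \<nu>) = sets borel"
    using sets_pair_measure_cong[OF s] unfolding borel_prod .
  with 1 2 show ?thesis
    by (simp add: couplings_def P.prob_space_axioms)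
qed

end

theory Submission
  imports Defs
begin

text \<open>
  Adding the same independent noise to both coordinates of a coupling leaves their difference
  unchanged, so \<open>W1 (\<mu> \<star> \<rho>) (\<nu> \<star> \<rho>) \<le> W1 \<mu> \<nu>\<close>
  (\<open>W1_convolution_le\<close>). Since Gaussians form a semigroup, passing from level \<open>s\<close> to a
  level \<open>t > s\<close> means adding common noise of level \<open>\<tau> = sqrt (t\<^sup>2 - s\<^sup>2)\<close>, which
  gives monotonicity.

  Continuity needs the opposite estimate, that adding noise of level \<open>\<tau>\<close> cannot decrease the
  distance by more than twice the mean length of the noise. This would follow from the triangle
  inequality for \<open>W1\<close>, whose proof glues two couplings along a common marginal and so
  disintegrates one of them. Here one of the two couplings is always that of a signal \<open>X\<close> with
  the noisy observation \<open>X + Z\<close>, and as \<open>Z\<close> has a density, Bayes' rule gives the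
  conditional law of \<open>X\<close> given \<open>X + Z = y\<close> explicitly. Replacing the first coordinate of
  a coupling by a sample from this posterior law removes the noise at an additional cost of at
  most the mean of \<open>norm Z\<close> (\<open>W1_le_W1_convolution_add\<close>). Doing so in both coordinates,
  and bounding the mean norm of the Gaussian by a constant times \<open>\<tau>\<close>, yields
  \<open>0 \<le> smooth_W1 s \<mu> \<nu> - smooth_W1 t \<mu> \<nu> \<le> C * sqrt (t\<^sup>2 - s\<^sup>2)\<close>
  for \<open>0 \<le> s \<le> t\<close> (\<open>smooth_W1_antimono_modulus\<close>). As \<open>s = 0\<close> is included, this
  also gives the limit at \<open>0\<close>.

  The distance need not vanish as the noise grows, because \<open>W1\<close> dominates the distance of the
  means and common noise shifts both means equally: for two Dirac measures the smoothed distance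
  is the distance of the two points at every noise level (\<open>smooth_W1_return\<close>).
\<close>

section \<open>Convolution with a measure of finite first moment\<close>

lemma P1_D:
  assumes "\<mu> \<in> P1"
  shows P1_prob: "prob_space \<mu>" and P1_sets: "sets \<mu> = sets borel"
    and P1_norm: "integrable \<mu> norm" and P1_finite: "finite_measure \<mu>"
  using assms by (auto simp: P1_def prob_space.finite_measure)

lemma prob_space_convolution:
  assumes "prob_space \<mu>" "prob_space \<rho>" "sets \<mu> = sets borel" "sets \<rho> = sets borel"
  shows "prob_space (\<mu> \<star> \<rho>)"
proof -
  note [measurable_cong] = assms(3,4)
  interpret pair_prob_space \<mu> \<rho>
    using assms by (simp add: pair_prob_space_def pair_sigma_finite_def prob_space_imp_sigma_finite)
  show ?thesis
    unfolding convolution_def by (rule P.prob_space_distr) simp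
qed

lemma integrable_norm_iff_nn_integral:
  fixes \<mu> :: "'a::euclidean_space measure"
  assumes [measurable_cong]: "sets \<mu> = sets borel"
  shows "integrable \<mu> norm \<longleftrightarrow> (\<integral>\<^sup>+x. norm x \<partial>\<mu>) < \<infinity>"
  by (simp add: integrable_iff_bounded)

lemma convolution_P1:
  assumes \<mu>: "\<mu> \<in> P1" and \<rho>: "\<rho> \<in> P1"
  shows "(\<mu> \<star> \<rho>) \<in> P1"
proof -
  note [measurable_cong] = P1_sets[OF \<mu>] P1_sets[OF \<rho>]
  interpret M: prob_space \<mu> using \<mu> by (rule P1_prob)
  interpret R: prob_space \<rho> using \<rho> by (rule P1_prob)
  have "(\<integral>\<^sup>+z. norm z \<partial>(\<mu> \<star> \<rho>)) = (\<integral>\<^sup>+x. \<integral>\<^sup>+z. norm (x + z) \<partial>\<rho> \<partial>\<mu>)"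
    by (rule nn_integral_convolution)
       (auto simp: P1_finite[OF \<mu>] P1_finite[OF \<rho>] P1_sets[OF \<mu>] P1_sets[OF \<rho>])
  also have "\<dots> \<le> (\<integral>\<^sup>+x. \<integral>\<^sup>+z. ennreal (norm x) + ennreal (norm z) \<partial>\<rho> \<partial>\<mu>)"
    by (intro nn_integral_mono) (auto simp flip: ennreal_plus intro!: ennreal_leI norm_triangle_ineq)
  also have "\<dots> = (\<integral>\<^sup>+x. norm x \<partial>\<mu>) + (\<integral>\<^sup>+z. norm z \<partial>\<rho>)"
    by (simp add: nn_integral_add M.emeasure_space_1 R.emeasure_space_1)
  also have "\<dots> < \<infinity>"
    using P1_norm[OF \<mu>] P1_norm[OF \<rho>] integrable_norm_iff_nn_integral[OF P1_sets[OF \<mu>]]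
      integrable_norm_iff_nn_integral[OF P1_sets[OF \<rho>]] by (simp add: ennreal_add_less_top)
  finally have "integrable (\<mu> \<star> \<rho>) norm"
    by (subst integrable_norm_iff_nn_integral) auto
  then show ?thesis
    using prob_space_convolution[OF P1_prob[OF \<mu>] P1_prob[OF \<rho>] P1_sets[OF \<mu>] P1_sets[OF \<rho>]]
    by (simp add: P1_def)
qed

lemma convolution_return_0:
  fixes \<mu> :: "'a::ordered_euclidean_space measure"
  assumes "\<mu> \<in> P1"
  shows "(\<mu> \<star> return borel 0) = \<mu>"
proof (rule measure_eqI)
  note [measurable_cong] = P1_sets[OF assms]
  fix A assume "A \<in> sets (\<mu> \<star> return borel 0)"
  then have [measurable]: "A \<in> sets borel" by simp
  have "emeasure (\<mu> \<star> return borel 0) A = (\<integral>\<^sup>+x. \<integral>\<^sup>+y. indicator A (x + y) \<partial>return borel 0 \<partial>\<mu>)"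
    by (rule convolution_emeasure')
      (auto simp: P1_finite[OF assms] P1_sets[OF assms] prob_space_return prob_space.finite_measure)
  also have "\<dots> = emeasure \<mu> A"
    by (simp add: nn_integral_return)
  finally show "emeasure (\<mu> \<star> return borel 0) A = emeasure \<mu> A" .
qed (simp add: P1_sets[OF assms])

lemma nn_integral_lborel_translate:
  fixes f :: "'a::euclidean_space \<Rightarrow> ennreal"
  assumes [measurable]: "f \<in> borel_measurable borel"
  shows "(\<integral>\<^sup>+z. f (x + z) \<partial>lborel) = (\<integral>\<^sup>+y. f y \<partial>lborel)"
proof -
  have "(\<integral>\<^sup>+y. f y \<partial>lborel) = (\<integral>\<^sup>+y. f y \<partial>distr lborel borel ((+) x))"
    by (simp add: lborel_distr_plus)
  also have "\<dots> = (\<integral>\<^sup>+z. f (x + z) \<partial>lborel)"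
    by (simp add: nn_integral_distr)
  finally show ?thesis ..
qed

text \<open>
  Convolving with an absolutely continuous measure yields a density, however singular \<open>\<mu>\<close>
  may be: the density at \<open>y\<close> averages over \<open>\<mu>\<close> the likelihood of the displacement \<open>y - x\<close>. This
  is used both for the Gaussian semigroup and as the denominator in Bayes' rule.
\<close>

lemma convolution_density_lborel:
  fixes \<mu> :: "'a::ordered_euclidean_space measure"
  assumes fin: "finite_measure \<mu>" "finite_measure (density lborel g)"
    and s: "sets \<mu> = sets borel"
    and [measurable]: "g \<in> borel_measurable borel"
  shows "(\<mu> \<star> density lborel g) = density lborel (\<lambda>y. \<integral>\<^sup>+x. g (y - x) \<partial>\<mu>)"
proof (rule measure_eqI)
  note [measurable_cong] = s
  interpret finite_measure \<mu> by fact
  interpret pair_sigma_finite \<mu> lborel ..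
  fix A assume "A \<in> sets (\<mu> \<star> density lborel g)"
  then have [measurable]: "A \<in> sets borel" by simp
  have "emeasure (\<mu> \<star> density lborel g) A
      = (\<integral>\<^sup>+x. \<integral>\<^sup>+z. indicator A (x + z) \<partial>density lborel g \<partial>\<mu>)"
    by (rule convolution_emeasure') (auto simp: fin s)
  also have "\<dots> = (\<integral>\<^sup>+x. \<integral>\<^sup>+z. g ((x + z) - x) * indicator A (x + z) \<partial>lborel \<partial>\<mu>)"
    by (simp add: nn_integral_density)
  also have "\<dots> = (\<integral>\<^sup>+x. \<integral>\<^sup>+y. g (y - x) * indicator A y \<partial>lborel \<partial>\<mu>)"
    by (subst nn_integral_lborel_translate[where f="\<lambda>y. g (y - x) * indicator A y" for x]) simp_all
  also have "\<dots> = (\<integral>\<^sup>+y. \<integral>\<^sup>+x. g (y - x) * indicator A y \<partial>\<mu> \<partial>lborel)"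
    by (rule Fubini'[symmetric]) simp
  also have "\<dots> = emeasure (density lborel (\<lambda>y. \<integral>\<^sup>+x. g (y - x) \<partial>\<mu>)) A"
    by (simp add: emeasure_density nn_integral_multc)
  finally show "emeasure (\<mu> \<star> density lborel g) A
      = emeasure (density lborel (\<lambda>y. \<integral>\<^sup>+x. g (y - x) \<partial>\<mu>)) A" .
qed simp

section \<open>Elementary properties of the transport cost\<close>

text \<open>
  Stating measurability with respect to the product \<open>\<sigma>\<close>-algebra makes the couplings
  accessible to Fubini's theorem and to the measurability prover.
\<close>

lemma couplings_pair_iff:
  "\<pi> \<in> couplings \<mu> \<nu> \<longleftrightarrow> prob_space \<pi> \<and> sets \<pi> = sets (borel \<Otimes>\<^sub>M borel) \<and>
     distr \<pi> borel fst = \<mu> \<and> distr \<pi> borel snd = \<nu>"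
  unfolding borel_prod by (simp add: couplings_def)

lemma W1_le:
  assumes "\<pi> \<in> couplings \<mu> \<nu>"
  shows "W1 \<mu> \<nu> \<le> (\<integral>(x, y). norm (x - y) \<partial>\<pi>)"
  unfolding W1_def
  by (rule cINF_lower[OF _ assms]) (auto intro!: bdd_belowI2[where m=0] integral_nonneg_AE)

lemma W1_greatest:
  assumes "\<mu> \<in> P1" "\<nu> \<in> P1"
    and "\<And>\<pi>. \<pi> \<in> couplings \<mu> \<nu> \<Longrightarrow> c \<le> (\<integral>(x, y). norm (x - y) \<partial>\<pi>)"
  shows "c \<le> W1 \<mu> \<nu>"
  unfolding W1_def using couplings_nonempty[OF assms(1,2)] assms(3)
  by (intro cINF_greatest) auto

lemma cost_eq_nn_integral:
  assumes "\<mu> \<in> P1" "\<nu> \<in> P1" "\<pi> \<in> couplings \<mu> \<nu>"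
  shows "(\<integral>\<^sup>+p. norm (fst p - snd p) \<partial>\<pi>) = ennreal (\<integral>(x, y). norm (x - y) \<partial>\<pi>)"
  using nn_integral_eq_integral[OF integrable_cost[OF assms]] by (simp add: case_prod_unfold)

lemma W1_commute_le:
  assumes "\<mu> \<in> P1" "\<nu> \<in> P1"
  shows "W1 \<nu> \<mu> \<le> W1 \<mu> \<nu>"
proof (rule W1_greatest[OF assms])
  fix \<pi> assume \<pi>: "\<pi> \<in> couplings \<mu> \<nu>"
  then have [measurable_cong]: "sets \<pi> = sets (borel \<Otimes>\<^sub>M borel)"
    and p: "prob_space \<pi>"
    by (simp_all add: couplings_pair_iff)
  let ?\<pi> = "distr \<pi> (borel \<Otimes>\<^sub>M borel) (\<lambda>p. (snd p, fst p))"
  have "?\<pi> \<in> couplings \<nu> \<mu>"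
    unfolding couplings_pair_iff
  proof (intro conjI)
    show "prob_space ?\<pi>"
      by (rule prob_space.prob_space_distr[OF p]) simp
    show "distr ?\<pi> borel fst = \<nu>" "distr ?\<pi> borel snd = \<mu>"
      using \<pi> by (simp_all add: couplings_def distr_distr comp_def)
  qed simp
  then have "W1 \<nu> \<mu> \<le> (\<integral>(x, y). norm (x - y) \<partial>?\<pi>)"
    by (rule W1_le)
  also have "\<dots> = (\<integral>(x, y). norm (x - y) \<partial>\<pi>)"
    by (simp add: integral_distr case_prod_unfold norm_minus_commute)
  finally show "W1 \<nu> \<mu> \<le> (\<integral>(x, y). norm (x - y) \<partial>\<pi>)" .
qed

lemma W1_commute: "\<mu> \<in> P1 \<Longrightarrow> \<nu> \<in> P1 \<Longrightarrow> W1 \<mu> \<nu> = W1 \<nu> \<mu>"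
  by (intro antisym W1_commute_le)

lemma integral_id_marginals:
  fixes \<pi> :: "('a::euclidean_space \<times> 'a) measure"
  assumes "\<mu> \<in> P1" "\<nu> \<in> P1" "\<pi> \<in> couplings \<mu> \<nu>"
  shows "integrable \<pi> fst" "integrable \<pi> snd"
    "(\<integral>p. fst p \<partial>\<pi>) = (\<integral>x. x \<partial>\<mu>)" "(\<integral>p. snd p \<partial>\<pi>) = (\<integral>x. x \<partial>\<nu>)"
proof -
  have [measurable_cong]: "sets \<pi> = sets (borel \<Otimes>\<^sub>M borel)"
    using assms(3) by (simp add: couplings_pair_iff)
  have d: "\<mu> = distr \<pi> borel fst" "\<nu> = distr \<pi> borel snd"
    using assms by (auto simp: couplings_def)
  have "integrable \<xi> (\<lambda>x. x)" if "\<xi> \<in> P1" for \<xi> :: "'a measure"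
  proof -
    note [measurable_cong] = P1_sets[OF that]
    show ?thesis
      using P1_norm[OF that] by (subst (asm) integrable_norm_iff) simp_all
  qed
  from this[OF assms(1)] this[OF assms(2)] have "integrable \<mu> (\<lambda>x. x)" "integrable \<nu> (\<lambda>x. x)" .
  then have i: "integrable (distr \<pi> borel fst) (\<lambda>x. x)" "integrable (distr \<pi> borel snd) (\<lambda>x. x)"
    unfolding d .
  have m: "fst \<in> measurable \<pi> borel" "snd \<in> measurable \<pi> borel"
    by measurable
  show "integrable \<pi> fst" "integrable \<pi> snd"
    using integrable_distr[OF m(1) i(1)] integrable_distr[OF m(2) i(2)] .
  show "(\<integral>p. fst p \<partial>\<pi>) = (\<integral>x. x \<partial>\<mu>)" "(\<integral>p. snd p \<partial>\<pi>) = (\<integral>x. x \<partial>\<nu>)"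
    unfolding d using integral_distr[OF m(1) measurable_ident_sets[OF refl]]
      integral_distr[OF m(2) measurable_ident_sets[OF refl]] by metis+
qed

text \<open>
  For any coupling, the difference of the means is the integral of \<open>x - y\<close>, whose norm is at
  most the integral of the norm.
\<close>

lemma norm_diff_means_le_W1:
  assumes "\<mu> \<in> P1" "\<nu> \<in> P1"
  shows "norm ((\<integral>x. x \<partial>\<mu>) - (\<integral>x. x \<partial>\<nu>)) \<le> W1 \<mu> \<nu>"
proof (rule W1_greatest[OF assms])
  fix \<pi> assume \<pi>: "\<pi> \<in> couplings \<mu> \<nu>"
  note m = integral_id_marginals[OF assms \<pi>]
  have "norm ((\<integral>x. x \<partial>\<mu>) - (\<integral>x. x \<partial>\<nu>)) = norm (\<integral>p. fst p - snd p \<partial>\<pi>)"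
    using m by (simp add: Bochner_Integration.integral_diff)
  also have "\<dots> \<le> (\<integral>(x, y). norm (x - y) \<partial>\<pi>)"
    using integral_norm_bound[of \<pi> "\<lambda>p. fst p - snd p"] by (simp add: case_prod_unfold)
  finally show "norm ((\<integral>x. x \<partial>\<mu>) - (\<integral>x. x \<partial>\<nu>)) \<le> (\<integral>(x, y). norm (x - y) \<partial>\<pi>)" .
qed

lemma integral_id_convolution:
  assumes \<mu>: "\<mu> \<in> P1" and \<rho>: "\<rho> \<in> P1"
  shows "(\<integral>x. x \<partial>(\<mu> \<star> \<rho>)) = (\<integral>x. x \<partial>\<mu>) + (\<integral>x. x \<partial>\<rho>)"
proof -
  note [measurable_cong] = P1_sets[OF \<mu>] P1_sets[OF \<rho>]
  note c = couplings_nonempty[OF \<mu> \<rho>]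
  note m = integral_id_marginals[OF \<mu> \<rho> c]
  have "(\<integral>x. x \<partial>(\<mu> \<star> \<rho>)) = (\<integral>p. fst p + snd p \<partial>(\<mu> \<Otimes>\<^sub>M \<rho>))"
    unfolding convolution_def by (simp add: integral_distr case_prod_unfold)
  then show ?thesis
    using m by (simp add: Bochner_Integration.integral_add)
qed

section \<open>Common noise\<close>

text \<open>
  If \<open>(X, Y)\<close> is a coupling and \<open>Z\<close> is independent of it, then \<open>(X + Z, Y + Z)\<close>
  couples the noisy laws at the same cost.
\<close>

lemma W1_convolution_le:
  assumes \<mu>: "\<mu> \<in> P1" and \<nu>: "\<nu> \<in> P1" and \<rho>: "\<rho> \<in> P1"
  shows "W1 (\<mu> \<star> \<rho>) (\<nu> \<star> \<rho>) \<le> W1 \<mu> \<nu>"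
proof (rule W1_greatest[OF \<mu> \<nu>])
  fix \<pi> assume \<pi>: "\<pi> \<in> couplings \<mu> \<nu>"
  have [measurable_cong]: "sets \<pi> = sets (borel \<Otimes>\<^sub>M borel)"
    using \<pi> by (simp add: couplings_pair_iff)
  note [measurable_cong] = P1_sets[OF \<rho>]
  interpret P: prob_space \<pi> using \<pi> by (simp add: couplings_def)
  interpret R: prob_space \<rho> using \<rho> by (rule P1_prob)
  interpret PR: pair_prob_space \<pi> \<rho> ..
  have d: "\<mu> = distr \<pi> borel fst" "\<nu> = distr \<pi> borel snd"
    using \<pi> by (auto simp: couplings_def)
  let ?T = "\<lambda>q. (fst (fst q) + snd q, snd (fst q) + snd q)"
  define \<kappa> where "\<kappa> = distr (\<pi> \<Otimes>\<^sub>M \<rho>) (borel \<Otimes>\<^sub>M borel) ?T"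
  have \<kappa>: "(\<integral>\<^sup>+p. f p \<partial>\<kappa>) = (\<integral>\<^sup>+p. \<integral>\<^sup>+z. f (fst p + z, snd p + z) \<partial>\<rho> \<partial>\<pi>)"
    if [measurable]: "f \<in> borel_measurable (borel \<Otimes>\<^sub>M borel)" for f
    by (simp add: \<kappa>_def nn_integral_distr flip: R.nn_integral_fst)
  have marg: "emeasure (\<xi> \<star> \<rho>) A = (\<integral>\<^sup>+p. \<integral>\<^sup>+z. indicator A (h p + z) \<partial>\<rho> \<partial>\<pi>)"
    if [measurable]: "A \<in> sets borel" "h \<in> borel_measurable (borel \<Otimes>\<^sub>M borel)"
      and \<xi>: "\<xi> = distr \<pi> borel h" for \<xi> A h
    unfolding \<xi>
    by (subst convolution_emeasure')
      (auto simp: nn_integral_distr P1_sets[OF \<rho>] R.finite_measure P.prob_space_distr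
        prob_space.finite_measure)
  have "\<kappa> \<in> couplings (\<mu> \<star> \<rho>) (\<nu> \<star> \<rho>)"
    unfolding couplings_pair_iff
  proof (intro conjI)
    show "prob_space \<kappa>"
      unfolding \<kappa>_def by (rule PR.prob_space_distr) simp
    show [measurable_cong]: "sets \<kappa> = sets (borel \<Otimes>\<^sub>M borel)"
      by (simp add: \<kappa>_def)
    show "distr \<kappa> borel fst = (\<mu> \<star> \<rho>)"
    proof (rule measure_eqI)
      fix A assume "A \<in> sets (distr \<kappa> borel fst)"
      then have [measurable]: "A \<in> sets borel" by simp
      have "emeasure (distr \<kappa> borel fst) A = (\<integral>\<^sup>+p. indicator A (fst p) \<partial>\<kappa>)"
        by (simp add: nn_integral_distr flip: nn_integral_indicator)
      then show "emeasure (distr \<kappa> borel fst) A = emeasure (\<mu> \<star> \<rho>) A"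
        by (simp add: \<kappa> marg[OF _ _ d(1)])
    qed simp
    show "distr \<kappa> borel snd = (\<nu> \<star> \<rho>)"
    proof (rule measure_eqI)
      fix A assume "A \<in> sets (distr \<kappa> borel snd)"
      then have [measurable]: "A \<in> sets borel" by simp
      have "emeasure (distr \<kappa> borel snd) A = (\<integral>\<^sup>+p. indicator A (snd p) \<partial>\<kappa>)"
        by (simp add: nn_integral_distr flip: nn_integral_indicator)
      then show "emeasure (distr \<kappa> borel snd) A = emeasure (\<nu> \<star> \<rho>) A"
        by (simp add: \<kappa> marg[OF _ _ d(2)])
    qed simp
  qed
  then have "W1 (\<mu> \<star> \<rho>) (\<nu> \<star> \<rho>) \<le> (\<integral>(x, y). norm (x - y) \<partial>\<kappa>)"
    by (rule W1_le)
  also have "\<dots> = (\<integral>q. norm (fst (fst q) - snd (fst q)) \<partial>(\<pi> \<Otimes>\<^sub>M \<rho>))"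
    by (simp add: \<kappa>_def integral_distr case_prod_unfold)
  also have "\<dots> = (\<integral>p. norm (fst p - snd p) \<partial>distr (\<pi> \<Otimes>\<^sub>M \<rho>) \<pi> fst)"
    by (simp add: integral_distr)
  also have "\<dots> = (\<integral>(x, y). norm (x - y) \<partial>\<pi>)"
    by (simp add: R.distr_pair_fst case_prod_unfold)
  finally show "W1 (\<mu> \<star> \<rho>) (\<nu> \<star> \<rho>) \<le> (\<integral>(x, y). norm (x - y) \<partial>\<pi>)" .
qed

section \<open>Removing noise by Bayes' rule\<close>

text \<open>
  Bayes' formula: the density with respect to \<open>\<mu>\<close> of the conditional law of the signal
  \<open>X\<close> with law \<open>\<mu>\<close>, given that \<open>X + Z = y\<close>, where the independent noise \<open>Z\<close> has
  Lebesgue density \<open>g\<close>.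
\<close>

definition posterior_density ::
    "'a::euclidean_space measure \<Rightarrow> ('a \<Rightarrow> ennreal) \<Rightarrow> 'a \<Rightarrow> 'a \<Rightarrow> ennreal" where
  "posterior_density \<mu> g y x = g (y - x) / (\<integral>\<^sup>+x'. g (y - x') \<partial>\<mu>)"

text \<open>
  Positivity and boundedness make the denominator of Bayes' formula positive and finite at
  every \<open>y\<close>, so that all posterior laws are probability measures without exceptional null
  sets.
\<close>

definition bounded_noise_density :: "('a::euclidean_space \<Rightarrow> ennreal) \<Rightarrow> bool" where
  "bounded_noise_density g \<longleftrightarrow>
     g \<in> borel_measurable borel \<and> (\<forall>z. 0 < g z) \<and> (\<exists>C<\<infinity>. \<forall>z. g z \<le> C) \<and> density lborel g \<in> P1"

context
  fixes \<mu> :: "'a::ordered_euclidean_space measure" and g :: "'a \<Rightarrow> ennreal"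
  assumes \<mu>: "\<mu> \<in> P1" and g: "bounded_noise_density g"
begin

interpretation M: prob_space \<mu>
  using \<mu> by (rule P1_prob)

lemma evidence_pos_finite:
  "(\<integral>\<^sup>+x. g (y - x) \<partial>\<mu>) \<noteq> 0" "(\<integral>\<^sup>+x. g (y - x) \<partial>\<mu>) < \<infinity>"
proof -
  note [measurable_cong] = P1_sets[OF \<mu>]
  have [measurable]: "g \<in> borel_measurable borel" and pos: "\<And>z. 0 < g z"
    using g by (auto simp: bounded_noise_density_def)
  obtain C where C: "C < \<infinity>" "\<And>z. g z \<le> C"
    using g by (auto simp: bounded_noise_density_def)
  show "(\<integral>\<^sup>+x. g (y - x) \<partial>\<mu>) \<noteq> 0"
  proof
    assume "(\<integral>\<^sup>+x. g (y - x) \<partial>\<mu>) = 0"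
    then have "AE x in \<mu>. g (y - x) = 0"
      by (subst (asm) nn_integral_0_iff_AE) auto
    then have "AE x in \<mu>. False"
      by eventually_elim (use pos in \<open>simp add: less_le\<close>)
    then show False
      by simp
  qed
  have "(\<integral>\<^sup>+x. g (y - x) \<partial>\<mu>) \<le> (\<integral>\<^sup>+x. C \<partial>\<mu>)"
    by (intro nn_integral_mono C)
  then show "(\<integral>\<^sup>+x. g (y - x) \<partial>\<mu>) < \<infinity>"
    using C(1) by (simp add: M.emeasure_space_1 order_le_less_trans)
qed

lemma measurable_posterior_density:
  assumes [measurable]: "Y \<in> borel_measurable M" "X \<in> borel_measurable M"
  shows "(\<lambda>q. posterior_density \<mu> g (Y q) (X q)) \<in> borel_measurable M"
proof -
  note [measurable_cong] = P1_sets[OF \<mu>]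
  have [measurable]: "g \<in> borel_measurable borel"
    using g by (auto simp: bounded_noise_density_def)
  show ?thesis
    unfolding posterior_density_def by measurable
qed

lemma nn_integral_posterior_density:
  "(\<integral>\<^sup>+x. posterior_density \<mu> g y x \<partial>\<mu>) = 1"
proof -
  note [measurable_cong] = P1_sets[OF \<mu>]
  have [measurable]: "g \<in> borel_measurable borel"
    using g by (auto simp: bounded_noise_density_def)
  show ?thesis
    unfolding posterior_density_def
    using evidence_pos_finite[of y] by (subst nn_integral_divide) (auto intro!: ennreal_divide_self)
qed

text \<open>
  Drawing first the observation and then the signal from its posterior law gives the same joint
  law as drawing the signal first and adding the noise. By \<open>convolution_density_lborel\<close>,
  the observation has as Lebesgue density the denominator of Bayes' formula, so this denominator
  cancels, and the claim reduces to Fubini and a translation.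
\<close>

lemma bayes_rule:
  assumes [measurable]: "f \<in> borel_measurable (borel \<Otimes>\<^sub>M borel)"
  shows "(\<integral>\<^sup>+y. \<integral>\<^sup>+x. posterior_density \<mu> g y x * f (x, y) \<partial>\<mu> \<partial>(\<mu> \<star> density lborel g)) =
    (\<integral>\<^sup>+x. \<integral>\<^sup>+z. f (x, x + z) \<partial>density lborel g \<partial>\<mu>)"
proof -
  note [measurable_cong] = P1_sets[OF \<mu>]
  note [measurable] = measurable_posterior_density
  have [measurable]: "g \<in> borel_measurable borel" and N: "density lborel g \<in> P1"
    using g by (auto simp: bounded_noise_density_def)
  interpret pair_sigma_finite \<mu> lborel ..
  let ?p = "\<lambda>y. \<integral>\<^sup>+x. g (y - x) \<partial>\<mu>"
  have "(\<mu> \<star> density lborel g) = density lborel ?p"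
    using \<mu> N by (intro convolution_density_lborel) (auto simp: P1_finite P1_sets)
  then have "(\<integral>\<^sup>+y. \<integral>\<^sup>+x. posterior_density \<mu> g y x * f (x, y) \<partial>\<mu> \<partial>(\<mu> \<star> density lborel g))
      = (\<integral>\<^sup>+y. ?p y * (\<integral>\<^sup>+x. posterior_density \<mu> g y x * f (x, y) \<partial>\<mu>) \<partial>lborel)"
    by (simp add: nn_integral_density)
  also have "\<dots> = (\<integral>\<^sup>+y. \<integral>\<^sup>+x. ?p y * (posterior_density \<mu> g y x * f (x, y)) \<partial>\<mu> \<partial>lborel)"
    by (simp add: nn_integral_cmult)
  also have "\<dots> = (\<integral>\<^sup>+y. \<integral>\<^sup>+x. g (y - x) * f (x, y) \<partial>\<mu> \<partial>lborel)"
  proof (intro nn_integral_cong)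
    fix y x
    have "?p y * posterior_density \<mu> g y x = g (y - x)"
      using evidence_pos_finite[of y] unfolding posterior_density_def
      by (simp add: ennreal_times_divide ennreal_mult_divide_eq mult.commute[of "?p y"])
    then show "?p y * (posterior_density \<mu> g y x * f (x, y)) = g (y - x) * f (x, y)"
      by (simp flip: mult.assoc)
  qed
  also have "\<dots> = (\<integral>\<^sup>+x. \<integral>\<^sup>+y. g (y - x) * f (x, y) \<partial>lborel \<partial>\<mu>)"
    by (rule Fubini') simp
  also have "\<dots> = (\<integral>\<^sup>+x. \<integral>\<^sup>+z. g ((x + z) - x) * f (x, x + z) \<partial>lborel \<partial>\<mu>)"
    by (subst nn_integral_lborel_translate[where f="\<lambda>y. g (y - x) * f (x, y)" for x]) simp_all
  also have "\<dots> = (\<integral>\<^sup>+x. \<integral>\<^sup>+z. f (x, x + z) \<partial>density lborel g \<partial>\<mu>)"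
    by (simp add: nn_integral_density)
  finally show ?thesis .
qed

text \<open>
  Given a coupling of a noisy law \<open>\<mu> \<star> N\<close> with \<open>\<nu>\<close>, draw a pair \<open>(y, v)\<close>
  from it and then \<open>x\<close> from the posterior law given \<open>y\<close>. The pair \<open>(x, v)\<close> is a
  coupling of \<open>\<mu>\<close> and \<open>\<nu>\<close>, and \<open>norm (x - v) \<le> norm (x - y) + norm (y - v)\<close>,
  where by \<open>bayes_rule\<close> the vector \<open>y - x\<close> is distributed like the noise.
\<close>

lemma W1_le_W1_convolution_add:
  assumes \<nu>: "\<nu> \<in> P1"
  shows "W1 \<mu> \<nu> \<le> W1 (\<mu> \<star> density lborel g) \<nu> + (\<integral>z. norm z \<partial>density lborel g)"
proof -
  define N where "N = density lborel g"
  note [measurable_cong] = P1_sets[OF \<mu>]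
  note w [measurable] = measurable_posterior_density
  have N: "N \<in> P1"
    using g by (simp add: N_def bounded_noise_density_def)
  note \<mu>N = convolution_P1[OF \<mu> N]
  note bayes = bayes_rule[folded N_def]
  interpret N: prob_space N using N by (rule P1_prob)
  note [measurable_cong] = P1_sets[OF N]
  have "W1 \<mu> \<nu> - (\<integral>z. norm z \<partial>N) \<le> W1 (\<mu> \<star> N) \<nu>"
  proof (rule W1_greatest[OF \<mu>N \<nu>])
    fix \<pi> assume \<pi>: "\<pi> \<in> couplings (\<mu> \<star> N) \<nu>"
    have [measurable_cong]: "sets \<pi> = sets (borel \<Otimes>\<^sub>M borel)"
      using \<pi> by (simp add: couplings_pair_iff)
    interpret P: prob_space \<pi> using \<pi> by (simp add: couplings_def)
    have d: "distr \<pi> borel fst = (\<mu> \<star> N)" "distr \<pi> borel snd = \<nu>"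
      using \<pi> by (auto simp: couplings_def)
    let ?w = "\<lambda>q. posterior_density \<mu> g (fst (fst q)) (snd q)"
    define \<kappa> where "\<kappa> = distr (density (\<pi> \<Otimes>\<^sub>M \<mu>) ?w)
      (borel \<Otimes>\<^sub>M borel) (\<lambda>q. (snd q, snd (fst q)))"
    have sets_\<kappa> [measurable_cong]: "sets \<kappa> = sets (borel \<Otimes>\<^sub>M borel)"
      by (simp add: \<kappa>_def)
    have \<kappa>: "(\<integral>\<^sup>+p. f p \<partial>\<kappa>) =
        (\<integral>\<^sup>+p. \<integral>\<^sup>+x. posterior_density \<mu> g (fst p) x * f (x, snd p) \<partial>\<mu> \<partial>\<pi>)"
      if [measurable]: "f \<in> borel_measurable (borel \<Otimes>\<^sub>M borel)" for f
      by (simp add: \<kappa>_def nn_integral_distr nn_integral_density flip: M.nn_integral_fst)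
    \<comment> \<open>The law of \<open>(x, y)\<close> depends on the coupling only through the law of \<open>y\<close>,
      so that Bayes' rule identifies it as the law of a signal with its noisy observation.\<close>
    have marg1: "(\<integral>\<^sup>+p. \<integral>\<^sup>+x. posterior_density \<mu> g (fst p) x * f (x, fst p) \<partial>\<mu> \<partial>\<pi>) =
        (\<integral>\<^sup>+x. \<integral>\<^sup>+z. f (x, x + z) \<partial>N \<partial>\<mu>)"
      if [measurable]: "f \<in> borel_measurable (borel \<Otimes>\<^sub>M borel)" for f
      unfolding bayes[OF that, symmetric] d(1)[symmetric]
      by (simp add: nn_integral_distr)
    have fst_\<kappa>: "emeasure (distr \<kappa> borel fst) A = emeasure \<mu> A"
      if [measurable]: "A \<in> sets borel" for A
    proof -
      have "emeasure (distr \<kappa> borel fst) A = (\<integral>\<^sup>+p. indicator A (fst p) \<partial>\<kappa>)"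
        by (simp add: nn_integral_distr flip: nn_integral_indicator)
      also have "\<dots> = (\<integral>\<^sup>+p. \<integral>\<^sup>+x. posterior_density \<mu> g (fst p) x * indicator A x \<partial>\<mu> \<partial>\<pi>)"
        by (simp add: \<kappa>)
      also have "\<dots> = (\<integral>\<^sup>+x. \<integral>\<^sup>+z. indicator A x \<partial>N \<partial>\<mu>)"
        using marg1[of "\<lambda>p. indicator A (fst p)"] by simp
      also have "\<dots> = emeasure \<mu> A"
        by (simp add: N.emeasure_space_1)
      finally show ?thesis .
    qed
    have snd_\<kappa>: "emeasure (distr \<kappa> borel snd) A = emeasure \<nu> A"
      if [measurable]: "A \<in> sets borel" for A
    proof -
      have "emeasure (distr \<kappa> borel snd) A = (\<integral>\<^sup>+p. indicator A (snd p) \<partial>\<kappa>)"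
        by (simp add: nn_integral_distr flip: nn_integral_indicator)
      also have "\<dots> = (\<integral>\<^sup>+p. indicator A (snd p) \<partial>\<pi>)"
        by (simp add: \<kappa> nn_integral_multc nn_integral_posterior_density)
      also have "\<dots> = emeasure (distr \<pi> borel snd) A"
        by (simp add: nn_integral_distr flip: nn_integral_indicator)
      finally show ?thesis
        by (simp add: d)
    qed
    have \<kappa>_coupling: "\<kappa> \<in> couplings \<mu> \<nu>"
      unfolding couplings_pair_iff
    proof (intro conjI sets_\<kappa>)
      show 1: "distr \<kappa> borel fst = \<mu>"
        using fst_\<kappa> by (intro measure_eqI) (simp_all add: P1_sets[OF \<mu>])
      show "distr \<kappa> borel snd = \<nu>"
        using snd_\<kappa> by (intro measure_eqI) (simp_all add: P1_sets[OF \<nu>])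
      show "prob_space \<kappa>"
        by (rule prob_space_distrD[of fst _ borel]) (simp_all add: 1 M.prob_space_axioms)
    qed
    have "ennreal (\<integral>(x, y). norm (x - y) \<partial>\<kappa>) = (\<integral>\<^sup>+p. norm (fst p - snd p) \<partial>\<kappa>)"
      using cost_eq_nn_integral[OF \<mu> \<nu> \<kappa>_coupling] ..
    also have "\<dots> = (\<integral>\<^sup>+p. \<integral>\<^sup>+x. posterior_density \<mu> g (fst p) x * norm (x - snd p) \<partial>\<mu> \<partial>\<pi>)"
      by (simp add: \<kappa>)
    also have "\<dots> \<le> (\<integral>\<^sup>+p. \<integral>\<^sup>+x. posterior_density \<mu> g (fst p) x * norm (x - fst p)
        + posterior_density \<mu> g (fst p) x * norm (fst p - snd p) \<partial>\<mu> \<partial>\<pi>)"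
    proof (intro nn_integral_mono)
      fix p :: "'a \<times> 'a" and x
      have "ennreal (norm (x - snd p)) \<le> ennreal (norm (x - fst p)) + ennreal (norm (fst p - snd p))"
        using norm_triangle_ineq[of "x - fst p" "fst p - snd p"]
        by (simp flip: ennreal_plus add: ennreal_leI)
      then show "posterior_density \<mu> g (fst p) x * norm (x - snd p)
        \<le> posterior_density \<mu> g (fst p) x * norm (x - fst p)
          + posterior_density \<mu> g (fst p) x * norm (fst p - snd p)"
        unfolding distrib_left[symmetric] by (intro mult_left_mono) simp_all
    qed
    also have "\<dots> = (\<integral>\<^sup>+p. \<integral>\<^sup>+x. posterior_density \<mu> g (fst p) x * norm (x - fst p) \<partial>\<mu> \<partial>\<pi>)
        + (\<integral>\<^sup>+p. norm (fst p - snd p) \<partial>\<pi>)"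
      by (simp add: nn_integral_add nn_integral_multc nn_integral_posterior_density)
    also have "(\<integral>\<^sup>+p. \<integral>\<^sup>+x. posterior_density \<mu> g (fst p) x * norm (x - fst p) \<partial>\<mu> \<partial>\<pi>)
        = (\<integral>\<^sup>+z. norm z \<partial>N)"
      using marg1[of "\<lambda>p. ennreal (norm (fst p - snd p))"] by (simp add: M.emeasure_space_1)
    also have "(\<integral>\<^sup>+z. norm z \<partial>N) = ennreal (\<integral>z. norm z \<partial>N)"
      using P1_norm[OF N] by (intro nn_integral_eq_integral) auto
    also have "(\<integral>\<^sup>+p. norm (fst p - snd p) \<partial>\<pi>) = ennreal (\<integral>(x, y). norm (x - y) \<partial>\<pi>)"
      by (rule cost_eq_nn_integral[OF \<mu>N \<nu> \<pi>])
    finally have le: "ennreal (\<integral>(x, y). norm (x - y) \<partial>\<kappa>)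
        \<le> ennreal (\<integral>z. norm z \<partial>N) + ennreal (\<integral>(x, y). norm (x - y) \<partial>\<pi>)" .
    have nonneg: "0 \<le> (\<integral>z. norm z \<partial>N)" "0 \<le> (\<integral>(x, y). norm (x - y) \<partial>\<pi>)"
      by (auto intro!: integral_nonneg_AE)
    from le have "(\<integral>(x, y). norm (x - y) \<partial>\<kappa>) \<le> (\<integral>z. norm z \<partial>N) + (\<integral>(x, y). norm (x - y) \<partial>\<pi>)"
      unfolding ennreal_plus[OF nonneg, symmetric] ennreal_le_iff[OF add_nonneg_nonneg[OF nonneg]] .
    then show "W1 \<mu> \<nu> - (\<integral>z. norm z \<partial>N) \<le> (\<integral>(x, y). norm (x - y) \<partial>\<pi>)"
      using W1_le[OF \<kappa>_coupling] by simp
  qed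
  then show ?thesis
    by (simp add: N_def)
qed

end

section \<open>Isotropic Gaussian noise\<close>

definition gaussian_density :: "real \<Rightarrow> 'a::euclidean_space \<Rightarrow> ennreal" where
  "gaussian_density \<sigma> x = (\<Prod>b\<in>Basis. ennreal (normal_density 0 \<sigma> (x \<bullet> b)))"

lemma borel_measurable_gaussian_density [measurable]:
  "gaussian_density \<sigma> \<in> borel_measurable borel"
  unfolding gaussian_density_def[abs_def] by measurable

text \<open>
  The coordinates of an isotropic Gaussian vector are independent. Written as a product, the
  density can be integrated coordinatewise, which reduces mass, moments and convolutions to
  the one-dimensional normal distribution.
\<close>

lemma isotropic_gaussian_eq_density:
  assumes "\<sigma> > 0"
  shows "(isotropic_gaussian \<sigma> :: 'a::euclidean_space measure) = density lborel (gaussian_density \<sigma>)"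
proof -
  have "(\<Prod>b\<in>Basis. normal_density 0 \<sigma> (x \<bullet> b))
      = exp (- (norm x)\<^sup>2 / (2 * \<sigma>\<^sup>2)) / sqrt (2 * pi * \<sigma>\<^sup>2) ^ DIM('a)" for x :: 'a
  proof -
    have "(norm x)\<^sup>2 = (\<Sum>b\<in>Basis. (x \<bullet> b)\<^sup>2)"
      unfolding power2_norm_eq_inner euclidean_inner[of x x] by (simp add: power2_eq_square)
    then show ?thesis
      by (simp add: normal_density_def prod_dividef sum_divide_distrib
          flip: exp_sum[OF finite_Basis] sum_negf)
  qed
  then show ?thesis
    using assms by (simp add: isotropic_gaussian_def gaussian_density_def[abs_def] prod_ennreal)
qed

lemma nn_integral_gaussian_density:
  assumes "\<sigma> > 0"
  shows "(\<integral>\<^sup>+x. gaussian_density \<sigma> (x::'a::euclidean_space) \<partial>lborel) = 1"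
  using assms unfolding gaussian_density_def
  by (subst nn_integral_lborel_prod) (simp_all add: nn_integral_eq_integral)

lemma nn_integral_abs_coordinate_gaussian:
  assumes "\<sigma> > 0" and b: "b \<in> Basis"
  shows "(\<integral>\<^sup>+x. ennreal \<bar>x \<bullet> b\<bar> * gaussian_density \<sigma> (x::'a::euclidean_space) \<partial>lborel)
    = ennreal (\<sigma> * sqrt (2 / pi))"
proof -
  \<comment> \<open>The integrand is again a product over the coordinates: the extra factor \<open>\<bar>t\<bar>\<close>
    belongs to the coordinate \<open>b\<close>.\<close>
  let ?f = "\<lambda>c t. ennreal (normal_density 0 \<sigma> t) * (if c = b then ennreal \<bar>t\<bar> else 1)"
  have "(\<integral>\<^sup>+x. ennreal \<bar>x \<bullet> b\<bar> * gaussian_density \<sigma> x \<partial>lborel)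
      = (\<integral>\<^sup>+x. (\<Prod>c\<in>Basis. ?f c (x \<bullet> c)) \<partial>lborel)"
    using b by (simp add: gaussian_density_def prod.distrib prod.delta' mult.commute)
  also have "\<dots> = (\<Prod>c\<in>Basis. \<integral>\<^sup>+t. ?f c t \<partial>lborel)"
    by (rule nn_integral_lborel_prod) simp_all
  also have "\<dots> = (\<Prod>c\<in>Basis. if c = b then ennreal (\<sigma> * sqrt (2 / pi)) else 1)"
  proof (intro prod.cong refl)
    fix c :: 'a
    have "has_bochner_integral lborel (\<lambda>t. normal_density 0 \<sigma> t * \<bar>t\<bar>) (\<sigma> * sqrt (2 / pi))"
      using normal_moment_abs_odd[of \<sigma> 0 0] assms by simp
    then have "(\<integral>\<^sup>+t. ennreal (normal_density 0 \<sigma> t * \<bar>t\<bar>) \<partial>lborel) = ennreal (\<sigma> * sqrt (2 / pi))"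
      by (subst nn_integral_eq_integral) (auto simp: has_bochner_integral_iff)
    then show "(\<integral>\<^sup>+t. ?f c t \<partial>lborel) = (if c = b then ennreal (\<sigma> * sqrt (2 / pi)) else 1)"
      using assms by (simp add: nn_integral_eq_integral ennreal_mult')
  qed
  also have "\<dots> = ennreal (\<sigma> * sqrt (2 / pi))"
    using b by (simp add: prod.delta)
  finally show ?thesis .
qed

text \<open>
  Bounding the Euclidean norm by the \<open>l\<^sup>1\<close>-norm reduces the mean norm to one-dimensional
  absolute moments. Only the linear dependence on \<open>\<sigma>\<close> matters for continuity, not the
  constant.
\<close>

lemma nn_integral_norm_gaussian_le:
  assumes "\<sigma> > 0"
  shows "(\<integral>\<^sup>+x. norm x \<partial>(isotropic_gaussian \<sigma> :: 'a::euclidean_space measure))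
    \<le> ennreal (real DIM('a) * sqrt (2 / pi) * \<sigma>)"
proof -
  have "(\<integral>\<^sup>+x. norm x \<partial>(isotropic_gaussian \<sigma> :: 'a measure))
      = (\<integral>\<^sup>+x. ennreal (norm (x::'a)) * gaussian_density \<sigma> x \<partial>lborel)"
    using assms by (simp add: isotropic_gaussian_eq_density nn_integral_density mult.commute)
  also have "\<dots> \<le> (\<integral>\<^sup>+x. (\<Sum>b\<in>Basis. ennreal \<bar>(x::'a) \<bullet> b\<bar> * gaussian_density \<sigma> x) \<partial>lborel)"
    by (intro nn_integral_mono)
      (auto simp flip: sum_distrib_right intro!: mult_right_mono ennreal_leI norm_le_l1)
  also have "\<dots> = (\<Sum>b\<in>(Basis::'a set). ennreal (\<sigma> * sqrt (2 / pi)))"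
    using assms by (simp add: nn_integral_sum nn_integral_abs_coordinate_gaussian)
  also have "\<dots> = ennreal (real DIM('a) * sqrt (2 / pi) * \<sigma>)"
    using assms by (subst sum_ennreal) (simp_all add: mult_ac)
  finally show ?thesis .
qed

lemma isotropic_gaussian_P1:
  assumes "\<sigma> \<ge> 0"
  shows "(isotropic_gaussian \<sigma> :: 'a::euclidean_space measure) \<in> P1"
proof (cases "\<sigma> = 0")
  case True
  then show ?thesis
    by (auto simp: P1_def isotropic_gaussian_def prob_space_return integrable_iff_bounded
      nn_integral_return)
next
  case False
  with assms have \<sigma>: "\<sigma> > 0" by simp
  let ?N = "isotropic_gaussian \<sigma> :: 'a measure"
  have s: "sets ?N = sets borel"
    using \<sigma> by (simp add: isotropic_gaussian_eq_density)
  have "emeasure ?N (space ?N) = 1"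
    using nn_integral_gaussian_density[OF \<sigma>, where 'a='a] \<sigma>
    by (simp add: isotropic_gaussian_eq_density emeasure_density)
  then have "prob_space ?N" by (rule prob_spaceI)
  moreover have "integrable ?N norm"
    using nn_integral_norm_gaussian_le[OF \<sigma>, where 'a='a]
    unfolding integrable_norm_iff_nn_integral[OF s] infinity_ennreal_def
    by (rule le_less_trans) (rule ennreal_less_top)
  ultimately show ?thesis
    using s by (simp add: P1_def)
qed

lemma integral_norm_gaussian_le:
  assumes "\<sigma> > 0"
  shows "(\<integral>x. norm x \<partial>(isotropic_gaussian \<sigma> :: 'a::euclidean_space measure))
    \<le> real DIM('a) * sqrt (2 / pi) * \<sigma>"
proof -
  have "integrable (isotropic_gaussian \<sigma> :: 'a measure) norm"
    using assms by (intro P1_norm isotropic_gaussian_P1) simp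
  then have "ennreal (\<integral>x. norm x \<partial>(isotropic_gaussian \<sigma> :: 'a measure))
      \<le> ennreal (real DIM('a) * sqrt (2 / pi) * \<sigma>)"
    using nn_integral_norm_gaussian_le[OF assms, where 'a='a] by (simp add: nn_integral_eq_integral)
  then show ?thesis
    using assms by (simp add: ennreal_le_iff)
qed

lemma bounded_noise_density_gaussian:
  assumes \<sigma>: "\<sigma> > 0"
  shows "bounded_noise_density (gaussian_density \<sigma> :: 'a::euclidean_space \<Rightarrow> ennreal)"
  unfolding bounded_noise_density_def
proof (intro conjI allI)
  fix z :: 'a
  have "gaussian_density \<sigma> z = ennreal (\<Prod>b\<in>Basis. normal_density 0 \<sigma> (z \<bullet> b))"
    by (simp add: gaussian_density_def prod_ennreal)
  moreover have "(\<Prod>b\<in>Basis. normal_density 0 \<sigma> (z \<bullet> b)) > 0"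
    by (intro prod_pos) (simp add: normal_density_pos \<sigma>)
  ultimately show "0 < gaussian_density \<sigma> z"
    by simp
next
  have "gaussian_density \<sigma> z \<le> ennreal ((1 / sqrt (2 * pi * \<sigma>\<^sup>2)) ^ DIM('a))" for z :: 'a
  proof -
    have "(\<Prod>b\<in>Basis. normal_density 0 \<sigma> (z \<bullet> b)) \<le> (\<Prod>b\<in>(Basis::'a set). 1 / sqrt (2 * pi * \<sigma>\<^sup>2))"
      by (intro prod_mono conjI normal_density_nonneg)
        (use \<sigma> in \<open>simp add: normal_density_def divide_right_mono\<close>)
    then show ?thesis
      by (simp add: gaussian_density_def prod_ennreal ennreal_leI)
  qed
  then show "\<exists>C<\<infinity>. \<forall>z::'a. gaussian_density \<sigma> z \<le> C"
    by (intro exI[of _ "ennreal ((1 / sqrt (2 * pi * \<sigma>\<^sup>2)) ^ DIM('a))"]) simp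
next
  show "density lborel (gaussian_density \<sigma>) \<in> (P1 :: 'a measure set)"
    using isotropic_gaussian_P1[of \<sigma>, where 'a='a] \<sigma> by (simp add: isotropic_gaussian_eq_density)
qed simp

text \<open>
  For \<open>\<sigma> > 0\<close> the convolution integral factorizes over the coordinates, and each
  factor is a convolution of two centred normal densities on the line, whose variances add.
  The case \<open>\<sigma> = 0\<close>, where the first factor is the Dirac measure at \<open>0\<close>, lets the noise
  level \<open>0\<close> be treated on the same footing as all others.
\<close>

lemma isotropic_gaussian_semigroup:
  assumes s: "\<sigma> \<ge> 0" and t: "\<tau> > 0"
  shows "(isotropic_gaussian \<sigma> \<star> isotropic_gaussian \<tau>)
    = (isotropic_gaussian (sqrt (\<sigma>\<^sup>2 + \<tau>\<^sup>2)) :: 'a::ordered_euclidean_space measure)"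
proof (cases "\<sigma> = 0")
  case True
  have P: "(isotropic_gaussian 0 :: 'a measure) \<in> P1" "(isotropic_gaussian \<tau> :: 'a measure) \<in> P1"
    using t by (simp_all add: isotropic_gaussian_P1)
  have "(isotropic_gaussian 0 \<star> isotropic_gaussian \<tau>)
      = (isotropic_gaussian \<tau> \<star> (isotropic_gaussian 0 :: 'a measure))"
    using P by (intro convolution_commutative P1_finite P1_sets)
  also have "\<dots> = isotropic_gaussian \<tau>"
    using convolution_return_0[OF P(2)] by (simp add: isotropic_gaussian_def[of 0])
  finally show ?thesis
    using True t by simp
next
  case False
  with s have s: "\<sigma> > 0" by simp
  have P: "(density lborel (gaussian_density \<sigma>) :: 'a measure) \<in> P1"
      "(density lborel (gaussian_density \<tau>) :: 'a measure) \<in> P1"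
    using bounded_noise_density_gaussian[OF s, where 'a='a]
      bounded_noise_density_gaussian[OF t, where 'a='a]
    by (simp_all add: bounded_noise_density_def)
  have conv: "(\<integral>\<^sup>+u. gaussian_density \<sigma> u * gaussian_density \<tau> (y - u) \<partial>lborel)
      = gaussian_density (sqrt (\<sigma>\<^sup>2 + \<tau>\<^sup>2)) y" for y :: 'a
  proof -
    have "(\<integral>\<^sup>+u. gaussian_density \<sigma> u * gaussian_density \<tau> (y - u) \<partial>lborel)
      = (\<integral>\<^sup>+u. (\<Prod>b\<in>Basis. ennreal (normal_density 0 \<tau> (y \<bullet> b - u \<bullet> b) * normal_density 0 \<sigma> (u \<bullet> b))) \<partial>lborel)"
      by (simp add: gaussian_density_def inner_diff_left ennreal_mult' prod.distrib mult.commute)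
    also have "\<dots> = (\<Prod>b\<in>Basis. \<integral>\<^sup>+v. ennreal (normal_density 0 \<tau> (y \<bullet> b - v) * normal_density 0 \<sigma> v) \<partial>lborel)"
      by (rule nn_integral_lborel_prod[where f="\<lambda>b v. ennreal (normal_density 0 \<tau> (y \<bullet> b - v) * normal_density 0 \<sigma> v)"]) simp_all
    also have "\<dots> = gaussian_density (sqrt (\<sigma>\<^sup>2 + \<tau>\<^sup>2)) y"
      using fun_cong[OF conv_normal_density_zero_mean[OF t s]]
      by (simp add: gaussian_density_def add.commute)
    finally show ?thesis .
  qed
  have "(density lborel (gaussian_density \<sigma>) \<star> density lborel (gaussian_density \<tau> :: 'a \<Rightarrow> ennreal))
      = density lborel (gaussian_density (sqrt (\<sigma>\<^sup>2 + \<tau>\<^sup>2)))"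
    using P by (subst convolution_density_lborel) (simp_all add: P1_finite nn_integral_density conv)
  then show ?thesis
    using s t by (simp add: isotropic_gaussian_eq_density add_pos_pos)
qed

section \<open>The smoothed distance\<close>

lemma smooth_W1_0:
  assumes "\<mu> \<in> P1" "\<nu> \<in> P1"
  shows "smooth_W1 0 \<mu> \<nu> = W1 \<mu> \<nu>"
  using assms by (simp add: smooth_W1_def isotropic_gaussian_def convolution_return_0)

text \<open>
  With \<open>\<tau> = sqrt (t\<^sup>2 - s\<^sup>2)\<close>, the measures at level \<open>t\<close> arise from those at level
  \<open>s\<close> by adding noise of level \<open>\<tau>\<close>. Adding it to both measures at once gives the first
  inequality. Removing it from one measure after the other gives the second, each removal
  costing at most the mean norm of the noise.
\<close>

lemma smooth_W1_antimono_modulus: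
  fixes \<mu> \<nu> :: "'a::ordered_euclidean_space measure"
  assumes \<mu>: "\<mu> \<in> P1" and \<nu>: "\<nu> \<in> P1" and s: "0 \<le> s" and st: "s \<le> t"
  shows "smooth_W1 t \<mu> \<nu> \<le> smooth_W1 s \<mu> \<nu>"
    "smooth_W1 s \<mu> \<nu> \<le> smooth_W1 t \<mu> \<nu> + 2 * real DIM('a) * sqrt (2 / pi) * sqrt (t\<^sup>2 - s\<^sup>2)"
proof -
  have "smooth_W1 t \<mu> \<nu> \<le> smooth_W1 s \<mu> \<nu> \<and>
    smooth_W1 s \<mu> \<nu> \<le> smooth_W1 t \<mu> \<nu> + 2 * real DIM('a) * sqrt (2 / pi) * sqrt (t\<^sup>2 - s\<^sup>2)"
  proof (cases "s = t")
    case False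
    define \<tau> where "\<tau> = sqrt (t\<^sup>2 - s\<^sup>2)"
    have \<tau>: "\<tau> > 0"
      using False s st by (simp add: \<tau>_def power_strict_mono)
    let ?N = "isotropic_gaussian :: real \<Rightarrow> 'a measure"
    have "sqrt (s\<^sup>2 + \<tau>\<^sup>2) = t"
      using s st by (simp add: \<tau>_def power_mono)
    then have N: "?N t = (?N s \<star> ?N \<tau>)"
      using isotropic_gaussian_semigroup[OF s \<tau>, where 'a='a] by simp
    have P: "?N s \<in> P1" "?N \<tau> \<in> P1"
      using s \<tau> by (simp_all add: isotropic_gaussian_P1)
    have t_eq: "(\<xi> \<star> ?N t) = ((\<xi> \<star> ?N s) \<star> ?N \<tau>)" if "\<xi> \<in> P1" for \<xi>
      unfolding N using that P by (intro convolution_associative P1_finite P1_sets)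
    note \<mu>s = convolution_P1[OF \<mu> P(1)] and \<nu>s = convolution_P1[OF \<nu> P(1)]
    have remove: "W1 \<alpha> \<beta> \<le> W1 (\<alpha> \<star> ?N \<tau>) \<beta> + (\<integral>z. norm z \<partial>?N \<tau>)"
      if "\<alpha> \<in> P1" "\<beta> \<in> P1" for \<alpha> \<beta>
      using W1_le_W1_convolution_add[OF that(1) bounded_noise_density_gaussian[OF \<tau>] that(2)]
      by (simp add: isotropic_gaussian_eq_density[OF \<tau>])
    define \<alpha> where "\<alpha> = (\<mu> \<star> ?N s)"
    define \<beta> where "\<beta> = (\<nu> \<star> ?N s)"
    have PP: "\<alpha> \<in> P1" "\<beta> \<in> P1" "(\<alpha> \<star> ?N \<tau>) \<in> P1" "(\<beta> \<star> ?N \<tau>) \<in> P1"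
      using \<mu>s \<nu>s P by (simp_all add: \<alpha>_def \<beta>_def convolution_P1)
    have eq: "smooth_W1 s \<mu> \<nu> = W1 \<alpha> \<beta>" "smooth_W1 t \<mu> \<nu> = W1 (\<alpha> \<star> ?N \<tau>) (\<beta> \<star> ?N \<tau>)"
      by (simp_all add: smooth_W1_def \<alpha>_def \<beta>_def t_eq \<mu> \<nu>)
    have "W1 \<alpha> \<beta> \<le> W1 \<beta> (\<alpha> \<star> ?N \<tau>) + (\<integral>z. norm z \<partial>?N \<tau>)"
      using remove[OF PP(1,2)] W1_commute[OF PP(3,2)] by simp
    also have "\<dots> \<le> W1 (\<alpha> \<star> ?N \<tau>) (\<beta> \<star> ?N \<tau>) + 2 * (\<integral>z. norm z \<partial>?N \<tau>)"
      using remove[OF PP(2,3)] W1_commute[OF PP(3,4)] by simp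
    also have "\<dots> \<le> W1 (\<alpha> \<star> ?N \<tau>) (\<beta> \<star> ?N \<tau>) + 2 * (real DIM('a) * sqrt (2 / pi) * \<tau>)"
      using integral_norm_gaussian_le[OF \<tau>, where 'a='a] by simp
    finally show ?thesis
      using W1_convolution_le[OF PP(1,2) P(2)] by (simp add: eq \<tau>_def mult.assoc)
  qed simp
  then show "smooth_W1 t \<mu> \<nu> \<le> smooth_W1 s \<mu> \<nu>"
    "smooth_W1 s \<mu> \<nu> \<le> smooth_W1 t \<mu> \<nu> + 2 * real DIM('a) * sqrt (2 / pi) * sqrt (t\<^sup>2 - s\<^sup>2)"
    by auto
qed

lemma continuous_on_smooth_W1:
  fixes \<mu> \<nu> :: "'a::ordered_euclidean_space measure"
  assumes "\<mu> \<in> P1" "\<nu> \<in> P1"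
  shows "continuous_on {0..} (\<lambda>\<sigma>. smooth_W1 \<sigma> \<mu> \<nu>)"
  unfolding continuous_on_def
proof
  fix s :: real assume s: "s \<in> {0..}"
  let ?C = "2 * real DIM('a) * sqrt (2 / pi)"
  have "\<bar>smooth_W1 t \<mu> \<nu> - smooth_W1 s \<mu> \<nu>\<bar> \<le> ?C * sqrt \<bar>t\<^sup>2 - s\<^sup>2\<bar>" if "t \<ge> 0" for t
  proof (cases "s \<le> t")
    case True
    have "s\<^sup>2 \<le> t\<^sup>2" using True s by (simp add: power_mono)
    with smooth_W1_antimono_modulus[OF assms _ True] s show ?thesis
      by (simp add: abs_le_iff)
  next
    case False
    then have "t \<le> s" by simp
    have "t\<^sup>2 \<le> s\<^sup>2" using \<open>t \<le> s\<close> that by (simp add: power_mono)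
    with smooth_W1_antimono_modulus[OF assms that \<open>t \<le> s\<close>] show ?thesis
      by (simp add: abs_le_iff)
  qed
  then have bound: "eventually (\<lambda>t. norm (smooth_W1 t \<mu> \<nu> - smooth_W1 s \<mu> \<nu>)
      \<le> ?C * sqrt \<bar>t\<^sup>2 - s\<^sup>2\<bar>) (at s within {0..})"
    unfolding eventually_at_filter by (simp add: eventually_mono)
  have "((\<lambda>t. ?C * sqrt \<bar>t\<^sup>2 - s\<^sup>2\<bar>) \<longlongrightarrow> ?C * sqrt \<bar>s\<^sup>2 - s\<^sup>2\<bar>) (at s within {0..})"
    by (intro tendsto_intros)
  then have "((\<lambda>t. ?C * sqrt \<bar>t\<^sup>2 - s\<^sup>2\<bar>) \<longlongrightarrow> 0) (at s within {0..})"
    by simp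
  with bound have "((\<lambda>t. smooth_W1 t \<mu> \<nu> - smooth_W1 s \<mu> \<nu>) \<longlongrightarrow> 0) (at s within {0..})"
    by (rule Lim_null_comparison)
  then show "((\<lambda>t. smooth_W1 t \<mu> \<nu>) \<longlongrightarrow> smooth_W1 s \<mu> \<nu>) (at s within {0..})"
    by (rule LIM_zero_cancel)
qed

lemma return_P1: "return borel a \<in> (P1 :: 'a::euclidean_space measure set)"
  by (auto simp: P1_def prob_space_return integrable_iff_bounded nn_integral_return)

text \<open>
  Common noise cannot increase the distance of the two points, and it leaves the difference of
  the means unchanged, which bounds the distance from below.
\<close>

lemma smooth_W1_return:
  fixes a b :: "'a::ordered_euclidean_space"
  assumes \<sigma>: "\<sigma> \<ge> 0"
  shows "smooth_W1 \<sigma> (return borel a) (return borel b) = norm (a - b)"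
proof (rule antisym)
  let ?a = "return borel a" and ?b = "return borel b" and ?N = "isotropic_gaussian \<sigma> :: 'a measure"
  note P = return_P1[of a] return_P1[of b] isotropic_gaussian_P1[OF \<sigma>, where 'a='a]
  have "smooth_W1 \<sigma> ?a ?b \<le> W1 ?a ?b"
    unfolding smooth_W1_def by (rule W1_convolution_le[OF P])
  also have "\<dots> \<le> (\<integral>(x, y). norm (x - y) \<partial>(?a \<Otimes>\<^sub>M ?b))"
    by (rule W1_le[OF couplings_nonempty[OF P(1,2)]])
  also have "\<dots> = norm (a - b)"
  proof -
    note [measurable_cong] = P1_sets[OF P(1)] P1_sets[OF P(2)]
    interpret B: prob_space ?b by (rule prob_space_return) simp
    have "ennreal (\<integral>(x, y). norm (x - y) \<partial>(?a \<Otimes>\<^sub>M ?b)) = (\<integral>\<^sup>+p. norm (fst p - snd p) \<partial>(?a \<Otimes>\<^sub>M ?b))"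
      by (rule cost_eq_nn_integral[OF P(1,2) couplings_nonempty[OF P(1,2)], symmetric])
    also have "\<dots> = ennreal (norm (a - b))"
      by (subst B.nn_integral_fst[symmetric]) (simp_all add: nn_integral_return)
    finally show ?thesis
      by (subst (asm) ennreal_inj) (auto intro!: integral_nonneg_AE)
  qed
  finally show "smooth_W1 \<sigma> ?a ?b \<le> norm (a - b)" .
  have "(\<integral>x. x \<partial>(?a \<star> ?N)) - (\<integral>x. x \<partial>(?b \<star> ?N)) = a - b"
    by (simp add: integral_id_convolution P integral_return)
  then show "norm (a - b) \<le> smooth_W1 \<sigma> ?a ?b"
    using norm_diff_means_le_W1[OF convolution_P1[OF P(1,3)] convolution_P1[OF P(2,3)]]
    by (simp add: smooth_W1_def)
qed

theorem theorem3:
  shows "(\<forall>\<mu>\<in>P1. \<forall>\<nu>\<in>(P1 :: (real ^ 'n) measure set).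
            (continuous_on {0..} (\<lambda>\<sigma>. smooth_W1 \<sigma> \<mu> \<nu>) \<and>
             antimono_on {0..} (\<lambda>\<sigma>. smooth_W1 \<sigma> \<mu> \<nu>)) \<and>
            ((\<lambda>\<sigma>. smooth_W1 \<sigma> \<mu> \<nu>) \<longlongrightarrow> W1 \<mu> \<nu>) (at_right 0)) \<and>
         (\<exists>\<mu>\<in>P1. \<exists>\<nu>\<in>(P1 :: (real ^ 'n) measure set). \<exists>L.
            ((\<lambda>\<sigma>. smooth_W1 \<sigma> \<mu> \<nu>) \<longlongrightarrow> L) at_top \<and> L \<noteq> 0)"
proof (intro conjI ballI)
  fix \<mu> \<nu> :: "(real ^ 'n) measure"
  assume P: "\<mu> \<in> P1" "\<nu> \<in> P1"
  show cont: "continuous_on {0..} (\<lambda>\<sigma>. smooth_W1 \<sigma> \<mu> \<nu>)"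
    by (rule continuous_on_smooth_W1[OF P])
  show "antimono_on {0..} (\<lambda>\<sigma>. smooth_W1 \<sigma> \<mu> \<nu>)"
    by (intro monotone_onI) (auto intro: smooth_W1_antimono_modulus[OF P])
  have "((\<lambda>\<sigma>. smooth_W1 \<sigma> \<mu> \<nu>) \<longlongrightarrow> smooth_W1 0 \<mu> \<nu>) (at 0 within {0..})"
    using cont by (simp add: continuous_on_def)
  then show "((\<lambda>\<sigma>. smooth_W1 \<sigma> \<mu> \<nu>) \<longlongrightarrow> W1 \<mu> \<nu>) (at_right 0)"
    unfolding smooth_W1_0[OF P] by (rule tendsto_within_subset) auto
next
  obtain e :: "real ^ 'n" where e: "e \<in> Basis"
    using nonempty_Basis by blast
  have "\<forall>\<^sub>F \<sigma> in at_top. smooth_W1 \<sigma> (return borel e) (return borel 0) = 1"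
    using eventually_ge_at_top[of 0] by eventually_elim (simp add: smooth_W1_return e)
  then have "((\<lambda>\<sigma>. smooth_W1 \<sigma> (return borel e) (return borel 0)) \<longlongrightarrow> 1) at_top"
    by (rule tendsto_eventually)
  then show "\<exists>\<mu>\<in>P1. \<exists>\<nu>\<in>(P1 :: (real ^ 'n) measure set). \<exists>L.
      ((\<lambda>\<sigma>. smooth_W1 \<sigma> \<mu> \<nu>) \<longlongrightarrow> L) at_top \<and> L \<noteq> 0"
    using return_P1[of e] return_P1[of "0 :: real ^ 'n"]
    by (intro bexI[of _ "return borel e"] bexI[of _ "return borel 0"] exI[of _ 1] conjI) simp_all
qed

end
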